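(* Let $a,b$ be non-negative integers with $\gcd(a,b)=1$ and let $n = a^2+ab+b^2$. Then each positive factor of $n$ is a $\mathcal{B}$-number.
   Context: A $\mathcal{B}$-number is an integer that can be written as $x^2+xy+y^2$ with non-negative integers $x \ge y$. *)

theory Defs
  imports Main
begin

definition B_number :: "int \<Rightarrow> bool" where
  "B_number m \<longleftrightarrow> (\<exists>x y. 0 \<le> y \<and> y \<le> x \<and> m = x^2 + x*y + y^2)"

end

theory Submission
  imports Defs
begin

text \<open>
  If \<open>d\<close> divides \<open>a\<^sup>2 + ab + b\<^sup>2\<close> with \<open>a, b\<close> coprime, then \<open>b\<close> is invertible modulo \<open>d\<close>, so
  \<open>d\<close> divides \<open>t\<^sup>2 + t + 1\<close> for some \<open>t\<close>. Hence \<open>d\<close> is the leading coefficient of a positive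
  definite binary quadratic form \<open>(d, 2t + 1, c)\<close> of discriminant \<open>-3\<close>. Reduction of forms shows
  that every such form is equivalent to \<open>x\<^sup>2 + xy + y\<^sup>2\<close>, which therefore represents \<open>d\<close>; the
  automorphisms of this form move the representation to the sector \<open>0 \<le> y \<le> x\<close>.
\<close>

text \<open>Swapping \<open>x\<close> and \<open>y\<close> or negating both preserves the form, so
  \<open>\<bar>y\<bar> \<le> x\<close> may be assumed. If then \<open>y < 0\<close>, passing to
  \<open>(x + y, -y)\<close> makes both entries non-negative.\<close>

lemma B_number_norm:
  fixes x y :: int
  shows "B_number (x^2 + x*y + y^2)"
proof -
  have ordered: "B_number (x^2 + x*y + y^2)" if "\<bar>y\<bar> \<le> x" for x y :: int
  proof (cases "0 \<le> y")
    case True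
    then show ?thesis
      using that unfolding B_number_def by auto
  next
    case False
    have sym: "x^2 + x*y + y^2 = (x + y)^2 + (x + y)*(-y) + (-y)^2"
      and comm: "x^2 + x*y + y^2 = (-y)^2 + (-y)*(x + y) + (x + y)^2"
      by (simp_all add: power2_eq_square algebra_simps)
    have "0 \<le> x + y" "0 \<le> -y"
      using that False by auto
    then show ?thesis
      unfolding B_number_def using sym comm linear[of "x + y" "-y"] by blast
  qed
  have "\<bar>y\<bar> \<le> x \<or> \<bar>y\<bar> \<le> -x \<or> \<bar>x\<bar> \<le> y \<or> \<bar>x\<bar> \<le> -y"
    by arith
  then show ?thesis
    using ordered[of y x] ordered[of "-y" "-x"] ordered[of x y] ordered[of "-x" "-y"]
    by (auto simp: algebra_simps)
qed

text \<open>The form \<open>(A, 2t + 1, C)\<close> is \<open>x\<^sup>2 + xy + y\<^sup>2\<close> after the substitution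
  \<open>x = pX + qY\<close>, \<open>y = rX + sY\<close>.\<close>

lemma form_discriminant_minus_3:
  fixes A t C :: int
  assumes "0 < A" and "A * C = t^2 + t + 1"
  shows "\<exists>p q r s. A = p^2 + p*r + r^2 \<and> C = q^2 + q*s + s^2 \<and>
           2*t + 1 = 2*p*q + p*s + q*r + 2*r*s"
  using assms
proof (induction "nat A" arbitrary: A t C rule: less_induct)
  case less
  show ?case
  proof (cases "A = 1")
    case True
    then have "A = 1^2 + 1*0 + 0^2 \<and> C = t^2 + t*1 + 1^2 \<and>
        2*t + 1 = 2*1*t + 1*1 + t*0 + 2*0*(1::int)"
      using less.prems by simp
    then show ?thesis by blast
  next
    case False
    \<comment> \<open>Rounding \<open>t / A\<close> makes \<open>t'\<close> a residue of
      \<open>t\<close> of least absolute value; \<open>C'\<close> is the last coefficient after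
      replacing \<open>X\<close> by \<open>X - k * Y\<close>.\<close>
    define k where "k = (t + A div 2) div A"
    define t' where "t' = t - k * A"
    define C' where "C' = C - k * (2*t' + 1) - k^2 * A"
    have t: "t = t' + k * A" by (simp add: t'_def)
    have AC': "A * C' = t'^2 + t' + 1"
      using less.prems(2) unfolding C'_def t
      by (simp add: power2_eq_square algebra_simps)
    have "t' = (t + A div 2) mod A - A div 2"
      unfolding t'_def k_def by (simp add: minus_div_mult_eq_mod[symmetric])
    moreover have "0 \<le> (t + A div 2) mod A" "(t + A div 2) mod A < A"
      using less.prems(1) by simp_all
    ultimately have "\<bar>2*t' + 1\<bar> \<le> A"
      by linarith
    then have "(2*t' + 1)^2 \<le> A^2"
      by (rule power2_le_iff_abs_le[THEN iffD2, rotated]) (use less.prems in simp)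
    then have "4 * (A * C') \<le> A^2 + 3"
      unfolding AC' by (simp add: power2_eq_square algebra_simps)
    moreover have "2 * 2 \<le> A * A"
      using less.prems(1) False by (intro mult_mono) auto
    ultimately have "A * C' < A * A"
      by (simp add: power2_eq_square)
    then have lt: "C' < A"
      using less.prems(1) by simp
    have "0 < 4 * (A * C')"
    proof -
      have "4 * (A * C') = (2*t' + 1)^2 + 3"
        unfolding AC' by (simp add: power2_eq_square algebra_simps)
      then show ?thesis
        using zero_le_power2[of "2*t' + 1"] by linarith
    qed
    then have pos: "0 < C'"
      using less.prems(1) by (simp add: zero_less_mult_iff)
    \<comment> \<open>Swapping the outer coefficients puts the smaller \<open>C'\<close> in front
      for the induction.\<close>
    have "C' * A = t'^2 + t' + 1"
      using AC' by (simp add: mult.commute)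
    then obtain p q r s where *: "C' = p^2 + p*r + r^2" "A = q^2 + q*s + s^2"
        "2*t' + 1 = 2*p*q + p*s + q*r + 2*r*s"
      using less.hyps[of C' A t'] lt pos by auto
    have "C = C' + k * (2*t' + 1) + k^2 * A"
      by (simp add: C'_def)
    also have "\<dots> = (p + k*q)^2 + (p + k*q)*(r + k*s) + (r + k*s)^2"
      unfolding * by (simp add: power2_eq_square algebra_simps)
    finally have C: "C = (p + k*q)^2 + (p + k*q)*(r + k*s) + (r + k*s)^2" .
    have "2*t + 1 = (2*t' + 1) + 2*k*A"
      by (simp add: t)
    also have "\<dots> = 2*q*(p + k*q) + q*(r + k*s) + (p + k*q)*s + 2*s*(r + k*s)"
      unfolding * by (simp add: power2_eq_square algebra_simps)
    finally show ?thesis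
      using *(2) C by blast
  qed
qed

theorem theorem13:
  fixes a b n :: int
  assumes "a \<ge> 0" and "b \<ge> 0"
    and "gcd a b = 1"
    and "n = a^2 + a*b + b^2"
  shows "\<forall>d. d > 0 \<and> d dvd n \<longrightarrow> B_number d"
proof (intro allI impI, elim conjE)
  fix d :: int
  assume d: "d > 0" "d dvd n"
  have "n = a^2 + (a + b)*b"
    by (simp add: assms(4) power2_eq_square algebra_simps)
  then have "gcd n b = gcd (a^2) b"
    by (metis gcd.commute gcd_add_mult add.commute)
  then have "coprime n b"
    using assms(3) by (simp add: coprime_iff_gcd_eq_1[symmetric])
  then have "coprime d b"
    using d(2) by (meson coprime_divisors dvd_refl)
  then obtain v u where uv: "v * d + u * b = 1"
    using bezout_int[of d b] by auto
  \<comment> \<open>Since \<open>u\<close> inverts \<open>b\<close> modulo \<open>d\<close>,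
    \<open>t\<close> plays the role of \<open>a / b\<close>.\<close>
  define t where "t = a * u"
  have ub: "u * b = 1 - v * d"
    using uv by simp
  have "u^2 * n = t^2 + t * (u * b) + (u * b)^2"
    by (simp add: assms(4) t_def power2_eq_square algebra_simps)
  also have "\<dots> = t^2 + t + 1 - d * (v * (t + 2 - v * d))"
    unfolding ub by (simp add: power2_eq_square algebra_simps)
  finally have "t^2 + t + 1 = u^2 * n + d * (v * (t + 2 - v * d))"
    by simp
  then have "d dvd t^2 + t + 1"
    using d(2) by simp
  then obtain c where "d * c = t^2 + t + 1"
    by (metis dvdE)
  then obtain p r where "d = p^2 + p*r + r^2"
    using form_discriminant_minus_3[OF d(1)] by blast
  then show "B_number d"
    by (simp add: B_number_norm)
qed

end
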